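(* Let $F:\mathbb{R}^n\rightrightarrows\mathbb{R}^n$ be a set-valued mapping with graph locally closed around $(\bar x,\bar y)\in\mathrm{gph}\,F$, and assume that $F$ is SCD semismooth$^*$ around $(\bar x,\bar y)$. Then $F$ is strongly metrically subregular around $(\bar x,\bar y)$ if and only if $F$ is SCD regular around $(\bar x,\bar y)$, and in this case one has $\mathrm{l\text{-}subreg}\,F(\bar x,\bar y)=\mathrm{scd\,reg}\,F(\bar x,\bar y)$.
   Context: Norms are Euclidean; $\mathcal{B}_\delta(z)$ is the closed ball. $\mathrm{gph}\,F=\{(x,y)\mid y\in F(x)\}$. For a set $A$ and $\bar z\in A$, the tangent cone $T_A(\bar z)$ is the set of all $w$ for which there are $t_k\downarrow0$, $w_k\to w$ with $\bar z+t_kw_k\in A$ for all $k$. $\mathcal{Z}_n$ is the set of $n$-dimensional linear subspaces of $\mathbb{R}^{2n}=\mathbb{R}^n\times\mathbb{R}^n$ with metric $d_{\mathcal{Z}}(L_1,L_2)=\|P_1-P_2\|$, $P_i$ the orthogonal projection onto $L_i$. $L^*:=\{(-v^*,u^* )\mid(u^*,v^* )\in L^\perp\}$. $\mathcal{Z}_n^{\rm reg}$ is the set of all $L\in\mathcal{Z}_n$ such that $(y^*,0)\in L\Rightarrow y^*=0$. $\mathcal{O}_F$ is the set of $(x,y)\in\mathrm{gph}\,F$ with $T_{\mathrm{gph}\,F}(x,y)\in\mathcal{Z}_n$. For $(x,y)\in\mathrm{gph}\,F$, $\mathcal{S}^*F(x,y)$ is the set of all $L\in\mathcal{Z}_n$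 for which there is a sequence $(x_k,y_k)\to(x,y)$ in $\mathcal{O}_F$ with $d_{\mathcal{Z}}(L,T_{\mathrm{gph}\,F}(x_k,y_k)^* )\to0$; $\bigcup\mathcal{S}^*F(x,y)$ is the union of these subspaces. $F$ has the SCD property at $(x,y)$ if $\mathcal{S}^*F(x,y)\neq\emptyset$, and around $(x,y)$ if it has it at all points of $\mathrm{gph}\,F$ in some neighborhood of $(x,y)$. $F$ is SCD regular around $(x,y)$ if it has the SCD property around $(x,y)$ and $\mathcal{S}^*F(x,y)\subseteq\mathcal{Z}_n^{\rm reg}$; $\mathrm{scd\,reg}\,F(x,y):=\sup\{\|y^*\|\mid(y^*,x^* )\in\bigcup\mathcal{S}^*F(x,y),\ \|x^*\|\le1\}$. $F$ is SCD semismooth$^*$ at $(\tilde x,\tilde y)\in\mathrm{gph}\,F$ if $F$ has the SCD property around $(\tilde x,\tilde y)$ and for every $\epsilon>0$ there is $\delta>0$ such that $|\langle x^*,x-\tilde x\rangle-\langle y^*,y-\tilde y\rangle|\le\epsilon\|(x,y)-(\tilde x,\tilde y)\|\,\|(x^*,y^* )\|$ for all $(x,y)\in\mathrm{gph}\,F\cap\mathcal{B}_\delta(\tilde x,\tilde y)$ and all $(y^*,x^* )\in\bigcup\mathcal{S}^*F(x,y)$. It is SCD semismooth$^*$ around $(\bar x,\bar y)$ if it is SCD semismooth$^*$ at every point of $\mathrm{gph}\,F$ in some neighborhood of $(\bar x,\bar y)$. $F$ is metrically subregular at $(x,y)\in\mathrm{gph}\,F$ if there are $\kappa\ge0$ and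 a neighborhood $X$ of $x$ with $\mathrm{dist}(x',F^{-1}(y))\le\kappa\,\mathrm{dist}(y,F(x'))$ for all $x'\in X$; $\mathrm{subreg}\,F(x,y)$ is the infimum of such $\kappa$ (over all neighborhoods $X$). $F$ is strongly metrically subregular at $(x,y)$ if, in addition, $F^{-1}(y)\cap X'=\{x\}$ for some neighborhood $X'$ of $x$. $F$ is strongly metrically subregular around $(\bar x,\bar y)$ if there is a neighborhood $W$ of $(\bar x,\bar y)$ such that $F$ is strongly metrically subregular at every point of $\mathrm{gph}\,F\cap W$ and $\mathrm{l\text{-}subreg}\,F(\bar x,\bar y):=\limsup_{(x,y)\to(\bar x,\bar y),\,(x,y)\in\mathrm{gph}\,F}\mathrm{subreg}\,F(x,y)<\infty$ (the point $(\bar x,\bar y)$ itself being allowed in the limsup). *)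

theory Defs
  imports "HOL-Analysis.Analysis"
begin

text \<open>
  A set-valued mapping is a function into sets. The definitions are stated over an arbitrary
  Euclidean space \<open>'a\<close>, with \<open>DIM('a)\<close> as the dimension; \<open>'a \<times> 'a\<close> carries the
  Euclidean product norm and inner product of the library. Points of the graph are pairs
  \<open>z = (x, y)\<close>. ``In some neighbourhood of \<open>z\<close>'' is expressed by \<open>eventually\<close> with respect
  to \<open>nhds z\<close>; this includes the point \<open>z\<close> itself.
\<close>

definition gph :: "('a \<Rightarrow> 'b set) \<Rightarrow> ('a \<times> 'b) set" where
  "gph F = {(x, y). y \<in> F x}"

definition set_valued_inv :: "('a \<Rightarrow> 'b set) \<Rightarrow> 'b \<Rightarrow> 'a set" where
  "set_valued_inv F y = {x. y \<in> F x}"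

definition locally_closed_around :: "'a::metric_space set \<Rightarrow> 'a \<Rightarrow> bool" where
  "locally_closed_around A z \<longleftrightarrow> (\<exists>r>0. closed (A \<inter> cball z r))"

definition tangent_cone :: "'a::real_normed_vector set \<Rightarrow> 'a \<Rightarrow> 'a set" where
  "tangent_cone A z =
     {w. \<exists>t ws. (\<forall>k::nat. t k > (0::real)) \<and> t \<longlonglongrightarrow> 0 \<and> ws \<longlonglongrightarrow> w \<and>
                (\<forall>k. z + t k *\<^sub>R ws k \<in> A)}"

definition half_dim_subspaces :: "('a::euclidean_space \<times> 'a) set set" where
  "half_dim_subspaces = {L. subspace L \<and> dim L = DIM('a)}"

definition orth_proj :: "'a::euclidean_space set \<Rightarrow> 'a \<Rightarrow> 'a" where
  "orth_proj L z = (THE p. p \<in> L \<and> z - p \<in> orthogonal_comp L)"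

lemma orth_proj:
  assumes "subspace L"
  shows "orth_proj L z \<in> L" "z - orth_proj L z \<in> orthogonal_comp L"
proof -
  have L: "span L = L"
    using assms by (simp add: span_eq_iff)
  obtain p q where pq: "p \<in> L" "\<And>w. w \<in> L \<Longrightarrow> orthogonal q w" "z = p + q"
    using orthogonal_subspace_decomp_exists[of L z] unfolding L by blast
  have "\<exists>!p. p \<in> L \<and> z - p \<in> orthogonal_comp L"
  proof (rule ex1I[of _ p])
    show "p \<in> L \<and> z - p \<in> orthogonal_comp L"
      using pq by (auto simp: orthogonal_comp_def orthogonal_commute)
  next
    fix p' assume p': "p' \<in> L \<and> z - p' \<in> orthogonal_comp L"
    then have "p - p' \<in> L"
      using pq(1) assms by (simp add: subspace_diff)
    then have "(p - p') \<bullet> (z - p') = 0" "(p - p') \<bullet> q = 0"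
      using p' pq(2)[of "p - p'"]
      by (simp_all add: orthogonal_comp_def orthogonal_def inner_commute[of q])
    then have "(p - p') \<bullet> (p - p') = 0"
      by (simp add: pq(3) inner_diff_right inner_add_right)
    then show "p' = p" by simp
  qed
  from theI'[OF this] show "orth_proj L z \<in> L" "z - orth_proj L z \<in> orthogonal_comp L"
    by (simp_all add: orth_proj_def)
qed

definition subspace_dist :: "'a::euclidean_space set \<Rightarrow> 'a set \<Rightarrow> real" where
  "subspace_dist L1 L2 = onorm (\<lambda>z. orth_proj L1 z - orth_proj L2 z)"

definition adjoint_subspace :: "('a::euclidean_space \<times> 'a) set \<Rightarrow> ('a \<times> 'a) set" where
  "adjoint_subspace L = {(- v, u) | u v. (u, v) \<in> orthogonal_comp L}"

definition regular_subspaces :: "('a::euclidean_space \<times> 'a) set set" where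
  "regular_subspaces = {L \<in> half_dim_subspaces. \<forall>y. (y, 0) \<in> L \<longrightarrow> y = 0}"

definition graphically_smooth_points ::
    "('a::euclidean_space \<Rightarrow> 'a set) \<Rightarrow> ('a \<times> 'a) set" where
  "graphically_smooth_points F = {z \<in> gph F. tangent_cone (gph F) z \<in> half_dim_subspaces}"

definition scd_adjoint ::
    "('a::euclidean_space \<Rightarrow> 'a set) \<Rightarrow> 'a \<times> 'a \<Rightarrow> ('a \<times> 'a) set set" where
  "scd_adjoint F z =
     {L \<in> half_dim_subspaces. \<exists>zs :: nat \<Rightarrow> 'a \<times> 'a.
        (\<forall>k. zs k \<in> graphically_smooth_points F) \<and> zs \<longlonglongrightarrow> z \<and>
        (\<lambda>k. subspace_dist L (adjoint_subspace (tangent_cone (gph F) (zs k)))) \<longlonglongrightarrow> 0}"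

definition scd_property_at :: "('a::euclidean_space \<Rightarrow> 'a set) \<Rightarrow> 'a \<times> 'a \<Rightarrow> bool" where
  "scd_property_at F z \<longleftrightarrow> scd_adjoint F z \<noteq> {}"

definition scd_property_around :: "('a::euclidean_space \<Rightarrow> 'a set) \<Rightarrow> 'a \<times> 'a \<Rightarrow> bool" where
  "scd_property_around F z \<longleftrightarrow> (\<forall>\<^sub>F w in nhds z. w \<in> gph F \<longrightarrow> scd_property_at F w)"

definition scd_regular_around :: "('a::euclidean_space \<Rightarrow> 'a set) \<Rightarrow> 'a \<times> 'a \<Rightarrow> bool" where
  "scd_regular_around F z \<longleftrightarrow> scd_property_around F z \<and> scd_adjoint F z \<subseteq> regular_subspaces"

text \<open>
  Elements of the adjoint subspaces are written \<open>(v, u)\<close> with \<open>v = y\<^sup>*\<close> and \<open>u = x\<^sup>*\<close>: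
  the argument of the generalized coderivative comes first, in contrast to \<open>(x, y)\<close> in the graph.
\<close>

definition scd_reg :: "('a::euclidean_space \<Rightarrow> 'a set) \<Rightarrow> 'a \<times> 'a \<Rightarrow> ereal" where
  "scd_reg F z = Sup {ereal (norm v) | u v. (v, u) \<in> \<Union>(scd_adjoint F z) \<and> norm u \<le> 1}"

definition scd_semismooth_at :: "('a::euclidean_space \<Rightarrow> 'a set) \<Rightarrow> 'a \<times> 'a \<Rightarrow> bool" where
  "scd_semismooth_at F z \<longleftrightarrow>
     z \<in> gph F \<and> scd_property_around F z \<and>
     (\<forall>\<epsilon>>0. \<exists>\<delta>>0. \<forall>w \<in> gph F \<inter> cball z \<delta>. \<forall>(v, u) \<in> \<Union>(scd_adjoint F w).
        \<bar>u \<bullet> (fst w - fst z) - v \<bullet> (snd w - snd z)\<bar> \<le> \<epsilon> * norm (w - z) * norm (u, v))"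

definition scd_semismooth_around :: "('a::euclidean_space \<Rightarrow> 'a set) \<Rightarrow> 'a \<times> 'a \<Rightarrow> bool" where
  "scd_semismooth_around F z \<longleftrightarrow> (\<forall>\<^sub>F w in nhds z. w \<in> gph F \<longrightarrow> scd_semismooth_at F w)"

text \<open>
  The distance to the empty set is \<open>\<infinity>\<close>, in contrast to \<^const>\<open>infdist\<close>.
\<close>

definition ext_infdist :: "'a::metric_space \<Rightarrow> 'a set \<Rightarrow> ereal" where
  "ext_infdist x A = (INF a\<in>A. ereal (dist x a))"

text \<open>
  In \<^typ>\<open>ereal\<close> the product \<open>0 * \<infinity>\<close> is \<open>0\<close>. This can only affect whether the constant
  \<open>\<kappa> = 0\<close> is admissible, hence neither the existence of an admissible constant nor the infimum.
\<close>

definition subreg_constant ::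
    "('a::metric_space \<Rightarrow> 'b::metric_space set) \<Rightarrow> 'a \<times> 'b \<Rightarrow> real \<Rightarrow> bool" where
  "subreg_constant F z \<kappa> \<longleftrightarrow>
     \<kappa> \<ge> 0 \<and>
     (\<forall>\<^sub>F x' in nhds (fst z).
        ext_infdist x' (set_valued_inv F (snd z)) \<le> ereal \<kappa> * ext_infdist (snd z) (F x'))"

definition metrically_subregular_at ::
    "('a::metric_space \<Rightarrow> 'b::metric_space set) \<Rightarrow> 'a \<times> 'b \<Rightarrow> bool" where
  "metrically_subregular_at F z \<longleftrightarrow> z \<in> gph F \<and> (\<exists>\<kappa>. subreg_constant F z \<kappa>)"

text \<open>The value is \<open>\<infinity>\<close> if there is no admissible constant.\<close>

definition subreg :: "('a::metric_space \<Rightarrow> 'b::metric_space set) \<Rightarrow> 'a \<times> 'b \<Rightarrow> ereal" where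
  "subreg F z = Inf {ereal \<kappa> | \<kappa>. subreg_constant F z \<kappa>}"

definition strongly_metrically_subregular_at ::
    "('a::metric_space \<Rightarrow> 'b::metric_space set) \<Rightarrow> 'a \<times> 'b \<Rightarrow> bool" where
  "strongly_metrically_subregular_at F z \<longleftrightarrow>
     metrically_subregular_at F z \<and>
     (\<exists>X. open X \<and> fst z \<in> X \<and> set_valued_inv F (snd z) \<inter> X = {fst z})"

text \<open>
  The filter is the trace of the neighbourhood filter on the graph; unlike
  \<open>at z within gph F\<close> it does not exclude the point \<open>z\<close>.
\<close>

definition l_subreg :: "('a::metric_space \<Rightarrow> 'b::metric_space set) \<Rightarrow> 'a \<times> 'b \<Rightarrow> ereal" where
  "l_subreg F z = Limsup (inf (nhds z) (principal (gph F))) (subreg F)"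

definition strongly_metrically_subregular_around ::
    "('a::metric_space \<Rightarrow> 'b::metric_space set) \<Rightarrow> 'a \<times> 'b \<Rightarrow> bool" where
  "strongly_metrically_subregular_around F z \<longleftrightarrow>
     (\<forall>\<^sub>F w in nhds z. w \<in> gph F \<longrightarrow> strongly_metrically_subregular_at F w) \<and>
     l_subreg F z < \<infinity>"

end

theory Submission
  imports Defs
begin

text \<open>
  Near a point \<open>z\<close> of the graph, strong metric subregularity with constant \<open>\<kappa>\<close> means
  \<open>\<parallel>x' - x\<parallel> \<le> \<kappa> \<parallel>y' - y\<parallel>\<close> for nearby \<open>x'\<close> and all \<open>y' \<in> F x'\<close>. This bound passes to the
  tangent cone; if the latter is a subspace of half dimension, duality gives \<open>\<parallel>v\<parallel> \<le> \<kappa> \<parallel>u\<parallel>\<close> for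
  all \<open>(v, u)\<close> in the adjoint subspace, and this survives limits of subspaces. Hence
  \<open>scd_reg \<le> l_subreg\<close>. Conversely, the set of subspaces of half dimension is compact, so SCD
  regularity at the reference point gives \<open>\<parallel>v\<parallel> \<le> \<kappa> \<parallel>u\<parallel>\<close> on all adjoint subspaces at nearby points,
  for any \<open>\<kappa> > scd_reg\<close>. Such a subspace contains a pair \<open>(v, u)\<close> with \<open>u = x' - x\<close>, and
  semismoothness then bounds \<open>\<parallel>x' - x\<parallel>\<^sup>2\<close> by \<open>v \<bullet> (y' - y)\<close> up to a small relative error.
\<close>

section \<open>Limits of subspaces\<close>

lemma orth_proj_unique:
  assumes "subspace L" "p \<in> L" "z - p \<in> orthogonal_comp L"
  shows "orth_proj L z = p"
proof -
  let ?q = "orth_proj L z"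
  have "?q - p \<in> L" "(z - p) - (z - ?q) \<in> orthogonal_comp L"
    using assms orth_proj[OF assms(1), of z]
    by (auto intro: subspace_diff simp only: subspace_diff[OF subspace_orthogonal_comp])
  then have "(?q - p) \<bullet> (?q - p) = 0"
    by (simp add: orthogonal_comp_def orthogonal_def)
  then show ?thesis by simp
qed

lemma orth_proj_self:
  assumes "subspace L" "p \<in> L"
  shows "orth_proj L p = p"
  using assms by (intro orth_proj_unique) (auto simp: subspace_0 subspace_orthogonal_comp)

lemma orth_proj_inner:
  assumes "subspace L"
  shows "(z - orth_proj L z) \<bullet> orth_proj L w = 0"
  using orth_proj[OF assms] by (auto simp: orthogonal_comp_def orthogonal_def inner_commute)

lemma norm_orth_proj_le:
  assumes "subspace L"
  shows "norm (orth_proj L z) \<le> norm z"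
proof -
  have "norm (orth_proj L z) * norm (orth_proj L z) = z \<bullet> orth_proj L z"
    using orth_proj_inner[OF assms, of z z]
    by (simp add: inner_diff_left flip: power2_eq_square power2_norm_eq_inner)
  also have "\<dots> \<le> norm z * norm (orth_proj L z)"
    by (rule norm_cauchy_schwarz)
  finally show ?thesis
    by (cases "orth_proj L z = 0") auto
qed

lemma bounded_linear_orth_proj:
  assumes L: "subspace L"
  shows "bounded_linear (orth_proj L)"
proof (rule bounded_linear_intro[where K = 1])
  note orth = subspace_orthogonal_comp[of L]
  fix a b and r :: real
  have "(a - orth_proj L a) + (b - orth_proj L b) \<in> orthogonal_comp L"
    by (intro subspace_add orth orth_proj L)
  then show "orth_proj L (a + b) = orth_proj L a + orth_proj L b"
    by (intro orth_proj_unique L subspace_add orth_proj) (simp add: algebra_simps)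
  have "r *\<^sub>R (a - orth_proj L a) \<in> orthogonal_comp L"
    by (intro subspace_scale orth orth_proj L)
  then show "orth_proj L (r *\<^sub>R a) = r *\<^sub>R orth_proj L a"
    by (intro orth_proj_unique L subspace_scale orth_proj) (simp add: algebra_simps)
  show "norm (orth_proj L a) \<le> norm a * 1"
    using norm_orth_proj_le[OF L] by simp
qed

text \<open>Bundling the projection as a bounded operator makes the metric on subspaces an operator
  norm and puts projections in a finite-dimensional space, where bounded sequences have convergent
  subsequences.\<close>

definition proj_op :: "'a::euclidean_space set \<Rightarrow> 'a \<Rightarrow>\<^sub>L 'a" where
  "proj_op L = Blinfun (orth_proj L)"

lemma proj_op_apply: "subspace L \<Longrightarrow> blinfun_apply (proj_op L) = orth_proj L"
  unfolding proj_op_def by (intro bounded_linear_Blinfun_apply bounded_linear_orth_proj)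

lemma norm_proj_op_le: "subspace L \<Longrightarrow> norm (proj_op L) \<le> 1"
  by (rule norm_blinfun_bound) (auto simp: proj_op_apply norm_orth_proj_le)

lemma subspace_dist_eq_norm:
  assumes "subspace A" "subspace B"
  shows "subspace_dist A B = norm (proj_op A - proj_op B)"
  using assms by (simp add: subspace_dist_def norm_blinfun.rep_eq minus_blinfun.rep_eq proj_op_apply)

text \<open>A vector of \<open>A\<close> annihilated by the projection onto \<open>B\<close> is
  fixed by the difference of the two projections. A difference of norm below 1 fixes only 0, so the
  projection embeds \<open>A\<close> into \<open>B\<close>.\<close>

lemma dim_le_if_proj_op_close:
  assumes A: "subspace A" and B: "subspace B" and close: "norm (proj_op A - proj_op B) < 1"
  shows "dim A \<le> dim B"
proof -
  interpret P: bounded_linear "orth_proj B"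
    by (rule bounded_linear_orth_proj[OF B])
  have "inj_on (orth_proj B) A"
  proof (rule inj_onI)
    fix a b assume ab: "a \<in> A" "b \<in> A" "orth_proj B a = orth_proj B b"
    then have "a - b \<in> A" and 0: "orth_proj B (a - b) = 0"
      by (auto simp: P.diff intro: subspace_diff A)
    then have "norm (a - b) = norm ((proj_op A - proj_op B) (a - b))"
      by (simp add: minus_blinfun.rep_eq proj_op_apply A B orth_proj_self)
    also have "\<dots> \<le> norm (proj_op A - proj_op B) * norm (a - b)"
      by (rule norm_blinfun)
    finally show "a = b"
      using close by (cases "a = b") (auto simp: mult_le_cancel_right1)
  qed
  then have "dim A = dim (orth_proj B ` A)"
    using A by (intro dim_image_eq[symmetric] P.linear) (simp add: span_eq_iff[THEN iffD2])
  also have "\<dots> \<le> dim B"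
    using orth_proj(1)[OF B] by (intro dim_subset) auto
  finally show ?thesis .
qed

text \<open>The orthogonality of \<open>x - P x\<close> to the range of \<open>P\<close> is a closed
  condition, and it identifies the limit as the projection onto its own range. Projections at
  distance below 1 have equal rank, so no dimension is lost.\<close>

lemma proj_op_limit:
  fixes L :: "nat \<Rightarrow> 'a::euclidean_space set"
  assumes L: "\<And>k. subspace (L k)" "\<And>k. dim (L k) = n"
    and lim: "(\<lambda>k. proj_op (L k)) \<longlonglongrightarrow> P"
  obtains M where "subspace M" "dim M = n" "P = proj_op M"
proof -
  have limc: "(\<lambda>k. orth_proj (L k) x) \<longlonglongrightarrow> P x" for x
    using blinfun.tendsto[OF lim tendsto_const] by (simp add: proj_op_apply L)
  have orth: "(x - P x) \<bullet> P w = 0" for x w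
  proof (rule LIMSEQ_unique)
    show "(\<lambda>k. (x - orth_proj (L k) x) \<bullet> orth_proj (L k) w) \<longlonglongrightarrow> (x - P x) \<bullet> P w"
      by (intro tendsto_intros limc)
  qed (simp add: orth_proj_inner L)
  define M where "M = range P"
  have M: "subspace M"
    unfolding M_def
    by (intro linear_subspace_image bounded_linear.linear[OF blinfun.bounded_linear_right] subspace_UNIV)
  have "orth_proj M x = P x" for x
    by (rule orth_proj_unique[OF M])
      (auto simp: M_def orthogonal_comp_def orthogonal_def inner_commute[of "P _"] orth)
  then have P: "P = proj_op M"
    by (intro blinfun_eqI) (simp add: proj_op_apply M)
  from lim have "\<forall>\<^sub>F k in sequentially. norm (proj_op (L k) - P) < 1"
    by (auto dest: tendstoD[where e = 1] simp: dist_norm)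
  then obtain k where "norm (proj_op (L k) - proj_op M) < 1"
    using P by (auto simp: eventually_sequentially)
  then have "dim M = n"
    using dim_le_if_proj_op_close[OF L(1)[of k] M] dim_le_if_proj_op_close[OF M L(1)[of k]] L(2)[of k]
    by (simp add: norm_minus_commute)
  with M P that show thesis by blast
qed

section \<open>Adjoint subspaces and their limits\<close>

lemma subspace_adjoint_subspace: "subspace (adjoint_subspace L)"
proof -
  have "linear (\<lambda>(a::'a, b::'a). (- b, a))"
    by (auto intro!: linearI)
  moreover have "adjoint_subspace L = (\<lambda>(a, b). (- b, a)) ` orthogonal_comp L"
    unfolding adjoint_subspace_def by force
  ultimately show ?thesis
    by (simp add: linear_subspace_image subspace_orthogonal_comp)
qed

lemma half_dim_subspacesD:
  "L \<in> half_dim_subspaces \<Longrightarrow> subspace L"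
  "(L :: ('a::euclidean_space \<times> 'a) set) \<in> half_dim_subspaces \<Longrightarrow> dim L = DIM('a)"
  by (auto simp: half_dim_subspaces_def)

text \<open>Compactness of the half-dimensional subspaces combined with a diagonal argument: a limit
  of members of \<open>scd_adjoint\<close> at points tending to \<open>z\<close> is again a limit of
  adjoint tangent spaces at smooth points tending to \<open>z\<close>.\<close>

lemma scd_adjoint_seq_compact:
  fixes F :: "'a::euclidean_space \<Rightarrow> 'a set"
  assumes zs: "zs \<longlonglongrightarrow> z" and ps: "\<And>k. ps k \<in> \<Union>(scd_adjoint F (zs k))" and bdd: "bounded (range ps)"
  obtains r p where "strict_mono r" "(ps \<circ> r) \<longlonglongrightarrow> p" "p \<in> \<Union>(scd_adjoint F z)"
proof -
  let ?adj = "\<lambda>w. adjoint_subspace (tangent_cone (gph F) w)"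
  have "\<forall>k. \<exists>L. L \<in> scd_adjoint F (zs k) \<and> ps k \<in> L"
    using ps by blast
  then obtain L where L: "\<And>k. L k \<in> scd_adjoint F (zs k)" "\<And>k. ps k \<in> L k"
    by metis
  then have Lh: "L k \<in> half_dim_subspaces" for k
    by (auto simp: scd_adjoint_def)
  have Ls: "subspace (L k)" for k
    using Lh by (rule half_dim_subspacesD)
  \<comment> \<open>Diagonal choice: \<open>L k\<close> is itself a limit, so a single smooth point
    can approximate \<open>zs k\<close> and \<open>L k\<close> at once.\<close>
  have "\<exists>w. w \<in> graphically_smooth_points F \<and> dist w (zs k) < 1 / Suc k \<and>
      subspace_dist (L k) (?adj w) < 1 / Suc k" for k
  proof -
    obtain ws where ws: "\<And>i. ws i \<in> graphically_smooth_points F" "ws \<longlonglongrightarrow> zs k"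
      "(\<lambda>i. subspace_dist (L k) (?adj (ws i))) \<longlonglongrightarrow> 0"
      using L(1)[of k] by (auto simp: scd_adjoint_def)
    have "\<forall>\<^sub>F i in sequentially. dist (ws i) (zs k) < 1 / Suc k"
      using ws(2) by (rule tendstoD) simp
    moreover have "\<forall>\<^sub>F i in sequentially. subspace_dist (L k) (?adj (ws i)) < 1 / Suc k"
      using ws(3) by (rule order_tendstoD) simp
    ultimately have "\<forall>\<^sub>F i in sequentially. dist (ws i) (zs k) < 1 / Suc k \<and>
        subspace_dist (L k) (?adj (ws i)) < 1 / Suc k"
      by (rule eventually_conj)
    then show ?thesis
      using ws(1) eventually_happens'[OF sequentially_bot] by blast
  qed
  then obtain w where w: "\<And>k. w k \<in> graphically_smooth_points F"
    "\<And>k. dist (w k) (zs k) < 1 / Suc k" "\<And>k. subspace_dist (L k) (?adj (w k)) < 1 / Suc k"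
    by metis
  have inv0: "(\<lambda>k. 1 / real (Suc k)) \<longlonglongrightarrow> 0"
    using LIMSEQ_inverse_real_of_nat by (simp add: inverse_eq_divide)
  have "(\<lambda>k. dist (w k) (zs k)) \<longlonglongrightarrow> 0"
    by (rule tendsto_sandwich[OF _ _ tendsto_const inv0]) (auto intro!: always_eventually less_imp_le w(2) simp del: of_nat_Suc)
  then have wz: "w \<longlonglongrightarrow> z"
    using tendsto_add[OF zs, of "\<lambda>k. w k - zs k" 0] by (simp add: dist_norm tendsto_norm_zero_iff)
  \<comment> \<open>Pairing operators with vectors yields one subsequence along which both
    converge.\<close>
  have "bounded (range (\<lambda>k. (proj_op (L k), ps k)))"
  proof (rule bounded_subset)
    show "bounded (cball 0 1 \<times> range ps)"
      by (intro bounded_Times bdd bounded_cball)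
  qed (auto simp: norm_proj_op_le Ls)
  then obtain q r where r: "strict_mono r" and q: "((\<lambda>k. (proj_op (L k), ps k)) \<circ> r) \<longlonglongrightarrow> q"
    using bounded_imp_convergent_subsequence by blast
  define P p where "P = fst q" and "p = snd q"
  have P: "(\<lambda>k. proj_op (L (r k))) \<longlonglongrightarrow> P" and p: "(\<lambda>k. ps (r k)) \<longlonglongrightarrow> p"
    using tendsto_fst[OF q] tendsto_snd[OF q] unfolding o_def P_def p_def by simp_all
  obtain M where M: "subspace M" "dim M = DIM('a)" "P = proj_op M"
    using proj_op_limit[OF _ _ P] Lh half_dim_subspacesD by metis
  \<comment> \<open>Membership in a subspace is being fixed by its projection, and this identity
    passes to the limit.\<close>
  have "(\<lambda>k. proj_op (L (r k)) (ps (r k))) \<longlonglongrightarrow> P p"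
    by (rule blinfun.tendsto[OF P p])
  then have "(\<lambda>k. ps (r k)) \<longlonglongrightarrow> orth_proj M p"
    by (simp add: M proj_op_apply Ls orth_proj_self L)
  then have "p = orth_proj M p"
    using p LIMSEQ_unique by blast
  then have pM: "p \<in> M"
    using orth_proj(1)[OF M(1), of p] by simp
  have "(\<lambda>k. subspace_dist M (?adj (w (r k)))) \<longlonglongrightarrow> 0"
  proof (rule tendsto_sandwich[OF _ _ tendsto_const])
    show "(\<lambda>k. norm (P - proj_op (L (r k))) + 1 / Suc (r k)) \<longlonglongrightarrow> 0"
    proof -
      have "(\<lambda>k. norm (P - proj_op (L (r k)))) \<longlonglongrightarrow> norm (P - P)"
        by (intro tendsto_intros P)
      moreover have "(\<lambda>k. 1 / real (Suc (r k))) \<longlonglongrightarrow> 0"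
        using LIMSEQ_subseq_LIMSEQ[OF inv0 r] by (simp add: o_def)
      ultimately show ?thesis
        using tendsto_add by fastforce
    qed
    show "\<forall>\<^sub>F k in sequentially. 0 \<le> subspace_dist M (?adj (w (r k)))"
      by (simp add: subspace_dist_eq_norm M subspace_adjoint_subspace)
    show "\<forall>\<^sub>F k in sequentially. subspace_dist M (?adj (w (r k)))
        \<le> norm (P - proj_op (L (r k))) + 1 / Suc (r k)"
    proof (rule always_eventually, rule allI)
      fix k
      have "norm (proj_op M - proj_op (?adj (w (r k)))) \<le> norm (proj_op M - proj_op (L (r k)))
          + norm (proj_op (L (r k)) - proj_op (?adj (w (r k))))"
        using norm_triangle_ineq[of "proj_op M - proj_op (L (r k))"
            "proj_op (L (r k)) - proj_op (?adj (w (r k)))"] by simp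
      then show "subspace_dist M (?adj (w (r k))) \<le> norm (P - proj_op (L (r k))) + 1 / Suc (r k)"
        using w(3)[of "r k"]
        by (simp add: subspace_dist_eq_norm M Ls subspace_adjoint_subspace)
    qed
  qed
  moreover have "(\<lambda>k. w (r k)) \<longlonglongrightarrow> z"
    using LIMSEQ_subseq_LIMSEQ[OF wz r] by (simp add: o_def)
  ultimately have "M \<in> scd_adjoint F z"
    using M w(1) by (auto simp: scd_adjoint_def half_dim_subspaces_def intro!: exI[of _ "\<lambda>k. w (r k)"])
  then show thesis
    using p pM by (intro that[OF r, of p]) (auto simp: o_def)
qed

text \<open>The second hypothesis makes \<open>snd\<close> injective on \<open>L\<close>; equality
  of the dimensions of \<open>L\<close> and the target then forces surjectivity. This serves both
  tangent spaces and members of \<open>scd_adjoint\<close>.\<close>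

lemma snd_surj_on_half_dim:
  fixes L :: "('a::euclidean_space \<times> 'a) set"
  assumes "L \<in> half_dim_subspaces" and "\<And>v. (v, 0) \<in> L \<Longrightarrow> v = 0"
  obtains v where "(v, u) \<in> L"
proof -
  have L: "subspace L" "dim L = DIM('a)"
    using assms half_dim_subspacesD by auto
  have inj: "inj_on snd L"
  proof (rule inj_onI)
    fix a b assume ab: "a \<in> L" "b \<in> L" "snd a = snd b"
    then have "a - b \<in> L"
      by (intro subspace_diff L)
    then have "fst (a - b) = 0"
      using assms(2)[of "fst (a - b)"] ab(3) by (cases a; cases b) simp
    then show "a = b"
      using ab(3) by (simp add: prod_eq_iff)
  qed
  then have "dim (snd ` L) = DIM('a)"
    using L dim_image_eq[OF linear_snd, of L] by (simp add: span_eq_iff[THEN iffD2])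
  then have "snd ` L = UNIV"
    using dim_eq_full[of "snd ` L"] L linear_subspace_image[OF linear_snd] by (metis span_eq_iff)
  then have "u \<in> snd ` L"
    by simp
  then show thesis
    using that by auto
qed

section \<open>Strong metric subregularity\<close>

text \<open>This is isolated calmness of the inverse mapping at \<open>snd z\<close> for
  \<open>fst z\<close>. It merges the distance estimate with the isolation of \<open>fst z\<close>
  and contains no distance to a set, so it can be evaluated along sequences in the graph.\<close>

definition isolated_calm_constant ::
    "('a::real_normed_vector \<Rightarrow> 'b::real_normed_vector set) \<Rightarrow> 'a \<times> 'b \<Rightarrow> real \<Rightarrow> bool" where
  "isolated_calm_constant F z \<kappa> \<longleftrightarrow>
     (\<forall>\<^sub>F x' in nhds (fst z). \<forall>y'\<in>F x'. norm (x' - fst z) \<le> \<kappa> * norm (y' - snd z))"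

lemma strongly_subregular_imp_calm:
  assumes "strongly_metrically_subregular_at F z" and \<kappa>: "subreg_constant F z \<kappa>"
  shows "isolated_calm_constant F z \<kappa>"
proof -
  obtain X where X: "open X" "fst z \<in> X" "set_valued_inv F (snd z) \<inter> X = {fst z}"
    using assms(1) by (auto simp: strongly_metrically_subregular_at_def)
  then obtain r where r: "r > 0" "ball (fst z) r \<subseteq> X"
    by (meson open_contains_ball)
  \<comment> \<open>Within half the isolating radius, \<open>fst z\<close> is a nearest point of the
    inverse image: every other point of it is at distance more than \<open>r / 2\<close> from
    \<open>x'\<close>.\<close>
  have "\<forall>\<^sub>F x' in nhds (fst z). x' \<in> ball (fst z) (r / 2)"
    using r(1) by (intro eventually_nhds_in_open) auto
  moreover have "\<forall>\<^sub>F x' in nhds (fst z). ext_infdist x' (set_valued_inv F (snd z))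
      \<le> ereal \<kappa> * ext_infdist (snd z) (F x')"
    using \<kappa> by (simp add: subreg_constant_def)
  ultimately show ?thesis
    unfolding isolated_calm_constant_def
  proof eventually_elim
    case (elim x')
    show ?case
    proof
      fix y' assume y': "y' \<in> F x'"
      have "dist x' (fst z) \<le> dist x' a" if "a \<in> set_valued_inv F (snd z)" for a
      proof (cases "a \<in> ball (fst z) r")
        case True
        then have "a = fst z"
          using r(2) X(3) that by blast
        then show ?thesis by simp
      next
        case False
        then show ?thesis
          using elim(1) dist_triangle[of "fst z" a x'] by (simp add: dist_commute)
      qed
      then have "ereal (dist x' (fst z)) \<le> ext_infdist x' (set_valued_inv F (snd z))"
        by (auto simp: ext_infdist_def intro!: INF_greatest)
      also have "\<dots> \<le> ereal \<kappa> * ext_infdist (snd z) (F x')"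
        by (rule elim(2))
      also have "\<dots> \<le> ereal \<kappa> * ereal (dist (snd z) y')"
        using \<kappa> y' by (intro ereal_mult_left_mono) (auto simp: ext_infdist_def subreg_constant_def intro: INF_lower)
      finally show "norm (x' - fst z) \<le> \<kappa> * norm (y' - snd z)"
        by (simp add: dist_norm norm_minus_commute)
    qed
  qed
qed

lemma calm_imp_strongly_subregular:
  assumes z: "z \<in> gph F" and \<kappa>: "\<kappa> > 0" and calm: "isolated_calm_constant F z \<kappa>"
  shows "strongly_metrically_subregular_at F z" "subreg_constant F z \<kappa>"
proof -
  have zF: "fst z \<in> set_valued_inv F (snd z)"
    using z by (auto simp: gph_def set_valued_inv_def)
  have "\<forall>\<^sub>F x' in nhds (fst z). ext_infdist x' (set_valued_inv F (snd z))
      \<le> ereal \<kappa> * ext_infdist (snd z) (F x')"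
    using calm unfolding isolated_calm_constant_def
  proof eventually_elim
    case (elim x')
    have "ext_infdist x' (set_valued_inv F (snd z)) \<le> ereal (dist x' (fst z))"
      unfolding ext_infdist_def using zF by (rule INF_lower)
    \<comment> \<open>Dividing by \<open>\<kappa> > 0\<close> reduces the claim to a lower bound for
      the infimum in \<open>ext_infdist\<close>, which also covers an empty
      \<open>F x'\<close>.\<close>
    also have "\<dots> = ereal \<kappa> * ereal (dist x' (fst z) / \<kappa>)"
      using \<kappa> by simp
    also have "\<dots> \<le> ereal \<kappa> * ext_infdist (snd z) (F x')"
    proof (rule ereal_mult_left_mono)
      show "ereal (dist x' (fst z) / \<kappa>) \<le> ext_infdist (snd z) (F x')"
        unfolding ext_infdist_def
      proof (rule INF_greatest)
        fix y' assume "y' \<in> F x'"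
        then show "ereal (dist x' (fst z) / \<kappa>) \<le> ereal (dist (snd z) y')"
          using elim \<kappa> by (simp add: dist_norm norm_minus_commute field_simps)
      qed
    qed (use \<kappa> in simp)
    finally show ?case .
  qed
  then show sub: "subreg_constant F z \<kappa>"
    using \<kappa> by (simp add: subreg_constant_def)
  obtain X where X: "open X" "fst z \<in> X"
    "\<And>x'. x' \<in> X \<Longrightarrow> \<forall>y'\<in>F x'. norm (x' - fst z) \<le> \<kappa> * norm (y' - snd z)"
    using calm by (auto simp: isolated_calm_constant_def eventually_nhds)
  have "x' = fst z" if "x' \<in> X" "snd z \<in> F x'" for x'
    using X(3)[OF that(1)] that(2) by fastforce
  then have "set_valued_inv F (snd z) \<inter> X = {fst z}"
    using zF X(2) unfolding set_valued_inv_def by blast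
  with X(1,2) sub z show "strongly_metrically_subregular_at F z"
    unfolding strongly_metrically_subregular_at_def metrically_subregular_at_def by blast
qed

section \<open>From calmness to bounds on tangent and adjoint subspaces\<close>

lemma calm_tangent_bound:
  assumes calm: "isolated_calm_constant F z \<kappa>" and ab: "(a, b) \<in> tangent_cone (gph F) z"
  shows "norm a \<le> \<kappa> * norm b"
proof -
  obtain t ws where t: "\<And>k. t k > (0::real)" "t \<longlonglongrightarrow> 0" and ws: "ws \<longlonglongrightarrow> (a, b)"
    and mem: "\<And>k. z + t k *\<^sub>R ws k \<in> gph F"
    using ab by (auto simp: tangent_cone_def)
  have a: "(\<lambda>k. fst (ws k)) \<longlonglongrightarrow> a" and b: "(\<lambda>k. snd (ws k)) \<longlonglongrightarrow> b"
    using tendsto_fst[OF ws] tendsto_snd[OF ws] by simp_all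
  have "(\<lambda>k. fst z + t k *\<^sub>R fst (ws k)) \<longlonglongrightarrow> fst z + 0 *\<^sub>R a"
    by (intro tendsto_intros t a)
  then have "\<forall>\<^sub>F k in sequentially. \<forall>y'\<in>F (fst z + t k *\<^sub>R fst (ws k)).
      norm (fst z + t k *\<^sub>R fst (ws k) - fst z) \<le> \<kappa> * norm (y' - snd z)"
    by (intro eventually_compose_filterlim[OF calm[unfolded isolated_calm_constant_def]])
      simp
  then have "\<forall>\<^sub>F k in sequentially. norm (fst (ws k)) \<le> \<kappa> * norm (snd (ws k))"
  \<comment> \<open>The inequality is homogeneous in the step length, so \<open>t k\<close> cancels
    before the limit is taken.\<close>
  proof eventually_elim
    case (elim k)
    have "snd z + t k *\<^sub>R snd (ws k) \<in> F (fst z + t k *\<^sub>R fst (ws k))"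
      using mem[of k] by (simp add: gph_def case_prod_beta)
    then have "t k * norm (fst (ws k)) \<le> t k * (\<kappa> * norm (snd (ws k)))"
      using elim t(1)[of k] by (fastforce simp: mult_ac)
    then show ?case
      using t(1)[of k] by (simp add: mult_le_cancel_left_pos)
  qed
  then show ?thesis
    by (intro tendsto_le[OF _ tendsto_mult[OF tendsto_const tendsto_norm[OF b]] tendsto_norm[OF a]]) auto
qed

text \<open>The bound makes \<open>snd\<close> injective on \<open>T\<close>, hence onto, so some
  \<open>(a, v)\<close> lies in \<open>T\<close>. Orthogonality of \<open>(u, - v)\<close> to it
  gives \<open>v \<bullet> v = u \<bullet> a\<close>, and the bound on \<open>a\<close> together
  with Cauchy-Schwarz finishes.\<close>

lemma adjoint_subspace_bound:
  fixes T :: "('a::euclidean_space \<times> 'a) set"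
  assumes T: "T \<in> half_dim_subspaces" and bound: "\<And>a b. (a, b) \<in> T \<Longrightarrow> norm a \<le> \<kappa> * norm b"
    and vu: "(v, u) \<in> adjoint_subspace T"
  shows "norm v \<le> \<kappa> * norm u"
proof -
  have surj: "\<exists>a. (a, b) \<in> T" for b
  proof -
    have "w = 0" if "(w, 0) \<in> T" for w
      using bound[OF that] by simp
    then show ?thesis
      using snd_surj_on_half_dim[OF T] by metis
  qed
  then obtain a where a: "(a, v) \<in> T"
    by blast
  have "(u, - v) \<in> orthogonal_comp T"
    using vu by (auto simp: adjoint_subspace_def)
  then have "v \<bullet> v = u \<bullet> a"
    using a by (auto simp: orthogonal_comp_def orthogonal_def inner_commute)
  then have "norm v * norm v \<le> norm u * norm a"
    using norm_cauchy_schwarz[of u a] by (simp add: power2_norm_eq_inner flip: power2_eq_square)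
  also have "\<dots> \<le> norm u * (\<kappa> * norm v)"
    by (intro mult_left_mono bound[OF a]) simp
  finally have "norm v * norm v \<le> (\<kappa> * norm u) * norm v"
    by (simp add: mult_ac)
  \<comment> \<open>Cancelling \<open>norm v\<close> fails for \<open>v = 0\<close>. The sign needed
    there comes from a tangent vector with second component \<open>u\<close>.\<close>
  moreover have "0 \<le> \<kappa> * norm u" if "v = 0"
  proof -
    obtain a where "(a, u) \<in> T"
      using surj by blast
    then have "norm a \<le> \<kappa> * norm u"
      by (rule bound)
    then show ?thesis
      using norm_ge_zero order_trans by blast
  qed
  ultimately show ?thesis
    by (cases "v = 0") auto
qed

lemma scd_adjoint_bound_of_calm:
  fixes F :: "'a::euclidean_space \<Rightarrow> 'a set"
  assumes calm: "\<forall>\<^sub>F w in nhds z. w \<in> gph F \<longrightarrow> isolated_calm_constant F w \<kappa>"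
    and vu: "(v, u) \<in> \<Union>(scd_adjoint F z)"
  shows "norm v \<le> \<kappa> * norm u"
proof -
  let ?A = "\<lambda>w. adjoint_subspace (tangent_cone (gph F) w)"
  obtain L zs where L: "L \<in> half_dim_subspaces" "(v, u) \<in> L"
    and zs: "\<And>k. zs k \<in> graphically_smooth_points F" "zs \<longlonglongrightarrow> z"
      "(\<lambda>k. subspace_dist L (?A (zs k))) \<longlonglongrightarrow> 0"
    using vu by (auto simp: scd_adjoint_def)
  have Ls: "subspace L"
    using L(1) by (rule half_dim_subspacesD)
  \<comment> \<open>Projecting the fixed pair onto the approximating subspaces gives pairs that
    satisfy the bound eventually and converge to \<open>(v, u)\<close>.\<close>
  define ps where "ps k = orth_proj (?A (zs k)) (v, u)" for k
  have "(\<lambda>k. proj_op L - proj_op (?A (zs k))) \<longlonglongrightarrow> 0"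
    using zs(3) by (simp add: subspace_dist_eq_norm Ls subspace_adjoint_subspace tendsto_norm_zero_iff)
  then have "(\<lambda>k. (proj_op L - proj_op (?A (zs k))) (v, u)) \<longlonglongrightarrow> blinfun_apply 0 (v, u)"
    by (intro blinfun.tendsto tendsto_const)
  then have "(\<lambda>k. (v, u) - ps k) \<longlonglongrightarrow> 0"
    by (simp add: minus_blinfun.rep_eq proj_op_apply Ls subspace_adjoint_subspace orth_proj_self L ps_def)
  then have "(\<lambda>k. (v, u) - ((v, u) - ps k)) \<longlonglongrightarrow> (v, u) - 0"
    by (intro tendsto_intros)
  then have ps: "ps \<longlonglongrightarrow> (v, u)"
    by simp
  from calm zs(2) have "\<forall>\<^sub>F k in sequentially. zs k \<in> gph F \<longrightarrow> isolated_calm_constant F (zs k) \<kappa>"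
    by (rule eventually_compose_filterlim)
  then have "\<forall>\<^sub>F k in sequentially. norm (fst (ps k)) \<le> \<kappa> * norm (snd (ps k))"
  proof eventually_elim
    case (elim k)
    have "ps k \<in> ?A (zs k)"
      unfolding ps_def by (intro orth_proj subspace_adjoint_subspace)
    then have mem: "(fst (ps k), snd (ps k)) \<in> ?A (zs k)"
      by simp
    have T: "zs k \<in> gph F" "tangent_cone (gph F) (zs k) \<in> half_dim_subspaces"
      using zs(1)[of k] by (auto simp only: graphically_smooth_points_def mem_Collect_eq)
    with elim have "isolated_calm_constant F (zs k) \<kappa>"
      by blast
    then show ?case
      by (rule adjoint_subspace_bound[OF T(2) calm_tangent_bound mem])
  qed
  then show ?thesis
    using tendsto_fst[OF ps] tendsto_snd[OF ps]
    by (intro tendsto_le[OF _ tendsto_mult[OF tendsto_const tendsto_norm] tendsto_norm]) auto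
qed

section \<open>SCD regularity\<close>

text \<open>If every \<open>P k\<close> fails arbitrarily close to \<open>z\<close>, violations of
  \<open>P k\<close> within \<open>1 / Suc k\<close> form one convergent sequence. The index lets
  the constant in an estimate grow along that sequence.\<close>

lemma eventually_nhds_sequentially_contr:
  fixes z :: "'a::metric_space"
  assumes "\<And>zs. zs \<longlonglongrightarrow> z \<Longrightarrow> (\<And>k. \<not> P k (zs k)) \<Longrightarrow> False"
  obtains k :: nat where "\<forall>\<^sub>F w in nhds z. P k w"
proof (rule ccontr)
  assume "\<not> thesis"
  then have neg: "\<not> (\<forall>\<^sub>F w in nhds z. P k w)" for k
    using that by blast
  have "\<exists>w. dist w z < 1 / Suc k \<and> \<not> P k w" for k
    using neg[of k] unfolding eventually_nhds_metric by (metis of_nat_0_less_iff zero_less_Suc zero_less_divide_1_iff)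
  then obtain zs where zs: "\<And>k. dist (zs k) z < 1 / Suc k" "\<And>k. \<not> P k (zs k)"
    by metis
  have "(\<lambda>k. 1 / real (Suc k)) \<longlonglongrightarrow> 0"
    using LIMSEQ_inverse_real_of_nat by (simp add: inverse_eq_divide)
  then have "(\<lambda>k. dist (zs k) z) \<longlonglongrightarrow> 0"
    by (rule tendsto_sandwich[OF _ _ tendsto_const, rotated 2]) (auto intro!: always_eventually less_imp_le zs(1) simp del: of_nat_Suc)
  then have "zs \<longlonglongrightarrow> z"
    by (rule tendsto_dist_iff[THEN iffD2])
  then show False
    using assms zs(2) by blast
qed

text \<open>The compactness argument shared by the next two bounds: violating pairs, scaled to norm
  1, accumulate at a unit pair in an adjoint subspace at \<open>z\<close>, and \<open>lim\<close>
  excludes this. With \<open>K = real\<close> it yields some bound, with a constant \<open>K\<close>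
  a prescribed one.\<close>

lemma eventually_scd_adjoint_bound:
  fixes F :: "'a::euclidean_space \<Rightarrow> 'a set" and K :: "nat \<Rightarrow> real"
  assumes K: "\<And>k. K k \<ge> 0"
    and lim: "\<And>r v u. strict_mono r \<Longrightarrow> (v, u) \<in> \<Union>(scd_adjoint F z) \<Longrightarrow> norm (v, u) = 1 \<Longrightarrow>
      \<not> (\<exists>vs us. vs \<longlonglongrightarrow> v \<and> us \<longlonglongrightarrow> u \<and> (\<forall>k. norm (vs k) \<le> 1 \<and> norm (vs k) > K (r k) * norm (us k)))"
  obtains k where "\<forall>\<^sub>F w in nhds z. \<forall>(v, u)\<in>\<Union>(scd_adjoint F w). norm v \<le> K k * norm u"
proof (rule eventually_nhds_sequentially_contr)
  fix zs assume zs: "zs \<longlonglongrightarrow> z"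
    and "\<And>k. \<not> (\<forall>(v, u)\<in>\<Union>(scd_adjoint F (zs k)). norm v \<le> K k * norm u)"
  then have "\<exists>q \<in> \<Union>(scd_adjoint F (zs k)). norm (fst q) > K k * norm (snd q)" for k
    unfolding case_prod_unfold by (meson not_le)
  then obtain qs where qs: "\<And>k. qs k \<in> \<Union>(scd_adjoint F (zs k))" "\<And>k. norm (fst (qs k)) > K k * norm (snd (qs k))"
    by metis
  have q0: "norm (qs k) > 0" for k
    using qs(2)[of k] by auto
  \<comment> \<open>The strict violation excludes the zero pair; scaling preserves both the
    violation and membership in the subspace.\<close>
  define ps where "ps k = inverse (norm (qs k)) *\<^sub>R qs k" for k
  have n: "norm (ps k) = 1" for k
    using q0[of k] by (auto simp: ps_def)
  have mem: "ps k \<in> \<Union>(scd_adjoint F (zs k))" for k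
    using qs(1)[of k] by (auto simp: ps_def scd_adjoint_def half_dim_subspaces_def intro: subspace_scale)
  have gt: "norm (fst (ps k)) > K k * norm (snd (ps k))" for k
  proof -
    have "inverse (norm (qs k)) * (K k * norm (snd (qs k))) < inverse (norm (qs k)) * norm (fst (qs k))"
      using q0[of k] qs(2)[of k] by (intro mult_strict_left_mono) auto
    then show ?thesis
      by (simp add: ps_def mult_ac)
  qed
  have "bounded (range ps)"
    by (rule boundedI[where B = 1]) (auto simp: n)
  then obtain r p where r: "strict_mono r" and p: "(ps \<circ> r) \<longlonglongrightarrow> p" "p \<in> \<Union>(scd_adjoint F z)"
    using scd_adjoint_seq_compact[OF zs mem] by metis
  have "(\<lambda>k. norm ((ps \<circ> r) k)) \<longlonglongrightarrow> norm p"
    by (intro tendsto_norm p)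
  then have "norm p = 1"
    by (simp add: n LIMSEQ_const_iff)
  moreover have "norm (fst (ps k)) \<le> 1" for k
    using norm_fst_le[of "fst (ps k)" "snd (ps k)"] n[of k] by simp
  moreover have "(\<lambda>k. fst (ps (r k))) \<longlonglongrightarrow> fst p" "(\<lambda>k. snd (ps (r k))) \<longlonglongrightarrow> snd p"
    using tendsto_fst[OF p(1)] tendsto_snd[OF p(1)] by (simp_all add: o_def)
  ultimately show False
    using lim[OF r, of "fst p" "snd p"] p(2) gt unfolding prod.collapse by blast
qed (use that in blast)

text \<open>Along unit violations with growing constants the \<open>u\<close>-components tend to 0.
  Regularity then makes the limiting \<open>v\<close> vanish too, contradicting norm 1.\<close>

lemma scd_regular_imp_bounded:
  fixes F :: "'a::euclidean_space \<Rightarrow> 'a set"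
  assumes reg: "scd_adjoint F z \<subseteq> regular_subspaces"
  obtains k :: nat where "\<forall>\<^sub>F w in nhds z. \<forall>(v, u)\<in>\<Union>(scd_adjoint F w). norm v \<le> real k * norm u"
proof (rule eventually_scd_adjoint_bound[of real])
  fix r :: "nat \<Rightarrow> nat" and v u :: 'a
  assume r: "strict_mono r" and vu: "(v, u) \<in> \<Union>(scd_adjoint F z)" "norm (v, u) = 1"
  show "\<not> (\<exists>vs us. vs \<longlonglongrightarrow> v \<and> us \<longlonglongrightarrow> u \<and> (\<forall>k. norm (vs k) \<le> 1 \<and> norm (vs k) > real (r k) * norm (us k)))"
  proof
    assume "\<exists>vs us. vs \<longlonglongrightarrow> v \<and> us \<longlonglongrightarrow> u \<and> (\<forall>k. norm (vs k) \<le> 1 \<and> norm (vs k) > real (r k) * norm (us k))"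
    then obtain vs us where "vs \<longlonglongrightarrow> v" and us: "us \<longlonglongrightarrow> u"
      and b: "\<forall>k. norm (vs k) \<le> 1 \<and> norm (vs k) > real (r k) * norm (us k)"
      by blast
    have "real k * norm (us k) \<le> 1" for k
    proof -
      \<comment> \<open>A strictly increasing index satisfies \<open>k \<le> r k\<close>.\<close>
      have "real k * norm (us k) \<le> real (r k) * norm (us k)"
        using seq_suble[OF r, of k] by (intro mult_right_mono) auto
      then show ?thesis
        using b[rule_format, of k] by linarith
    qed
    then have "norm (us k) \<le> 1 / real k" if "k > 0" for k
      using that by (simp add: field_simps)
    then have "(\<lambda>k. norm (us k)) \<longlonglongrightarrow> 0"
      by (intro tendsto_sandwich[OF _ _ tendsto_const lim_1_over_n])
        (auto simp: eventually_sequentially intro!: exI[of _ 1])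
    then have "u = 0"
      using us LIMSEQ_unique tendsto_norm_zero_iff by blast
    moreover from this have "v = 0"
      using vu(1) reg unfolding regular_subspaces_def by blast
    ultimately show False
      using vu(2) by simp
  qed
qed (use that in auto)

section \<open>The modulus \<open>scd_reg\<close>\<close>

lemma scd_adjoint_norm_le_scd_reg:
  assumes "(v, u) \<in> \<Union>(scd_adjoint F z)" "u \<noteq> 0"
  shows "ereal (norm v / norm u) \<le> scd_reg F z"
proof -
  obtain L where L: "L \<in> scd_adjoint F z" "(v, u) \<in> L"
    using assms by blast
  then have "subspace L"
    by (auto simp: scd_adjoint_def dest: half_dim_subspacesD)
  then have "inverse (norm u) *\<^sub>R (v, u) \<in> L"
    using L(2) by (rule subspace_scale)
  then show ?thesis
    unfolding scd_reg_def using L assms(2)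
    by (intro Sup_upper CollectI exI[of _ "inverse (norm u) *\<^sub>R u"] exI[of _ "inverse (norm u) *\<^sub>R v"])
      (auto simp: divide_inverse mult.commute)
qed

lemma scd_reg_le:
  assumes "\<And>v u. (v, u) \<in> \<Union>(scd_adjoint F z) \<Longrightarrow> norm v \<le> \<kappa> * norm u" "\<kappa> \<ge> 0"
  shows "scd_reg F z \<le> ereal \<kappa>"
  unfolding scd_reg_def
proof (rule Sup_least)
  fix c assume "c \<in> {ereal (norm v) | u v. (v, u) \<in> \<Union>(scd_adjoint F z) \<and> norm u \<le> 1}"
  then obtain u v where c: "c = ereal (norm v)"
    and *: "(v, u) \<in> \<Union>(scd_adjoint F z)" "norm u \<le> 1"
    by blast
  have "norm v \<le> \<kappa> * norm u"
    by (rule assms(1)[OF *(1)])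
  also have "\<dots> \<le> \<kappa> * 1"
    using * assms(2) by (intro mult_left_mono)
  finally show "c \<le> ereal \<kappa>"
    by (simp add: c)
qed

text \<open>The SCD property supplies a subspace and with it the zero pair; over an empty set the
  supremum in \<open>ereal\<close> would be minus infinity.\<close>

lemma scd_reg_nonneg:
  assumes "scd_property_at F z"
  shows "0 \<le> scd_reg F z"
proof -
  obtain L where L: "L \<in> scd_adjoint F z"
    using assms by (auto simp: scd_property_at_def)
  then have "(0, 0) \<in> L"
    using subspace_0[of L] by (auto simp: scd_adjoint_def half_dim_subspaces_def zero_prod_def)
  with L have "ereal (norm (0 :: 'a)) \<le> scd_reg F z"
    unfolding scd_reg_def by (intro Sup_upper) force
  then show ?thesis
    by (simp add: zero_ereal_def)
qed

text \<open>A unit pair at \<open>z\<close> has \<open>u \<noteq> 0\<close> by regularity, so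
  \<open>norm v < \<kappa> * norm u\<close> holds strictly and cannot be the limit of
  violations.\<close>

lemma eventually_scd_adjoint_bound_scd_reg:
  fixes F :: "'a::euclidean_space \<Rightarrow> 'a set"
  assumes reg: "scd_adjoint F z \<subseteq> regular_subspaces" and \<kappa>: "scd_reg F z < ereal \<kappa>" "\<kappa> \<ge> 0"
  shows "\<forall>\<^sub>F w in nhds z. \<forall>(v, u)\<in>\<Union>(scd_adjoint F w). norm v \<le> \<kappa> * norm u"
proof -
  \<comment> \<open>The index is a dummy, as the family of constants is constant.\<close>
  have "\<exists>k::nat. \<forall>\<^sub>F w in nhds z. \<forall>(v, u)\<in>\<Union>(scd_adjoint F w). norm v \<le> \<kappa> * norm u"
  proof (rule eventually_scd_adjoint_bound[of "\<lambda>_. \<kappa>"])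
    fix r :: "nat \<Rightarrow> nat" and v u :: 'a
    assume vu: "(v, u) \<in> \<Union>(scd_adjoint F z)" "norm (v, u) = 1"
    have "v = 0" if "u = 0"
      using vu(1) reg that unfolding regular_subspaces_def by blast
    then have "u \<noteq> 0"
      using vu(2) by (auto simp: zero_prod_def[symmetric])
    then have less: "norm v < \<kappa> * norm u"
      using order.strict_trans1[OF scd_adjoint_norm_le_scd_reg[OF vu(1)] \<kappa>(1)] by (simp add: field_simps)
    show "\<not> (\<exists>vs us. vs \<longlonglongrightarrow> v \<and> us \<longlonglongrightarrow> u \<and> (\<forall>k. norm (vs k) \<le> 1 \<and> norm (vs k) > \<kappa> * norm (us k)))"
    proof
      assume "\<exists>vs us. vs \<longlonglongrightarrow> v \<and> us \<longlonglongrightarrow> u \<and> (\<forall>k. norm (vs k) \<le> 1 \<and> norm (vs k) > \<kappa> * norm (us k))"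
      then obtain vs us where vs: "vs \<longlonglongrightarrow> v" and us: "us \<longlonglongrightarrow> u"
        and b: "\<forall>k. norm (vs k) \<le> 1 \<and> norm (vs k) > \<kappa> * norm (us k)"
        by blast
      have "\<kappa> * norm u \<le> norm v"
        by (rule tendsto_le[OF _ tendsto_norm[OF vs] tendsto_mult[OF tendsto_const tendsto_norm[OF us]]])
          (auto intro!: always_eventually less_imp_le simp: b)
      with less show False by simp
    qed
  qed (use \<kappa> in auto)
  then show ?thesis by simp
qed

text \<open>The adjoint bound makes \<open>snd\<close> bijective on each available subspace, so
  semismoothness can be tested with a pair \<open>(v, u)\<close> whose \<open>u\<close> is the
  displacement \<open>fst w - fst z\<close> itself.\<close>

lemma semismooth_imp_calm:
  fixes F :: "'a::euclidean_space \<Rightarrow> 'a set"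
  assumes ss: "scd_semismooth_at F z" and "0 \<le> \<kappa>" "\<kappa> < \<kappa>'"
    and bound: "\<forall>\<^sub>F w in nhds z. \<forall>(v, u)\<in>\<Union>(scd_adjoint F w). norm v \<le> \<kappa> * norm u"
  shows "isolated_calm_constant F z \<kappa>'"
proof -
  text \<open>The value of \<open>e\<close> solves \<open>\<kappa> + e = \<kappa>' (1 - e)\<close>.\<close>
  define e where "e = (\<kappa>' - \<kappa>) / (1 + \<kappa>')"
  have e: "0 < e" "e * (1 + \<kappa>') = \<kappa>' - \<kappa>" "e < 1"
    using assms(2,3) by (auto simp: e_def)
  \<comment> \<open>The factor \<open>1 + \<kappa>\<close> in the tolerance cancels against
    \<open>norm (?a, v) \<le> (1 + \<kappa>) * norm ?a\<close>.\<close>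
  have "e / (1 + \<kappa>) > 0"
    using e assms(2) by simp
  then obtain \<delta> where "\<delta> > 0" and \<delta>: "\<forall>w \<in> gph F \<inter> cball z \<delta>. \<forall>(v, u) \<in> \<Union>(scd_adjoint F w).
        \<bar>u \<bullet> (fst w - fst z) - v \<bullet> (snd w - snd z)\<bar> \<le> e / (1 + \<kappa>) * norm (w - z) * norm (u, v)"
    using ss[unfolded scd_semismooth_at_def, THEN conjunct2, THEN conjunct2, THEN spec, THEN mp]
    by blast
  have "\<forall>\<^sub>F w in nhds z. w \<in> gph F \<longrightarrow> scd_property_at F w"
    using ss by (simp add: scd_semismooth_at_def scd_property_around_def)
  moreover have "\<forall>\<^sub>F w in nhds z. w \<in> ball z \<delta>"
    using \<open>\<delta> > 0\<close> by (intro eventually_nhds_in_open) auto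
  ultimately have near: "\<forall>\<^sub>F w in nhds z. w \<in> gph F \<longrightarrow> norm (fst w - fst z) \<le> \<kappa>' * norm (snd w - snd z)"
    using bound
  proof eventually_elim
    case (elim w)
    show ?case
    proof
      assume w: "w \<in> gph F"
      let ?a = "fst w - fst z" and ?b = "snd w - snd z"
      obtain L where L: "L \<in> scd_adjoint F w"
        using elim(1) w by (auto simp: scd_property_at_def)
      have "v = 0" if "(v, 0) \<in> L" for v
        using elim(3) L that by fastforce
      then obtain v where v: "(v, ?a) \<in> L"
        using snd_surj_on_half_dim[of L] L by (auto simp: scd_adjoint_def)
      have nv: "norm v \<le> \<kappa> * norm ?a"
        using elim(3) L v by blast
      have nw: "norm (w - z) \<le> norm ?a + norm ?b"
        using norm_Pair_le[of ?a ?b] by (simp add: minus_prod_def)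
      have nav: "norm (?a, v) \<le> (1 + \<kappa>) * norm ?a"
        using norm_Pair_le[of ?a v] nv by (simp add: algebra_simps)
      have "norm ?a * norm ?a = ?a \<bullet> ?a"
        by (simp add: power2_norm_eq_inner flip: power2_eq_square)
      also have "\<dots> \<le> v \<bullet> ?b + e / (1 + \<kappa>) * norm (w - z) * norm (?a, v)"
        using \<delta> w elim(2) L v by fastforce
      also have "\<dots> \<le> (\<kappa> * norm ?a) * norm ?b
          + e / (1 + \<kappa>) * (norm ?a + norm ?b) * ((1 + \<kappa>) * norm ?a)"
        using e assms(2) nw nav
        by (intro add_mono order_trans[OF norm_cauchy_schwarz] mult_right_mono[OF nv] mult_mono) auto
      also have "\<dots> = (\<kappa> * norm ?b + e * (norm ?a + norm ?b)) * norm ?a"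
        using assms(2) by (simp add: field_simps)
      finally have "norm ?a \<le> \<kappa> * norm ?b + e * (norm ?a + norm ?b)"
        using e assms(2) by (cases "?a = 0") (auto simp: mult_le_cancel_right)
      \<comment> \<open>The error term in \<open>norm ?a\<close> is absorbed on the left, which is
        possible because \<open>e < 1\<close>.\<close>
      then have "(1 - e) * norm ?a \<le> (\<kappa> + e) * norm ?b"
        by (simp add: algebra_simps)
      also have "\<kappa> + e = (1 - e) * \<kappa>'"
        using e(2) by (simp add: algebra_simps)
      finally show "norm ?a \<le> \<kappa>' * norm ?b"
        using e(3) by (simp add: mult.assoc mult_le_cancel_left_pos)
    qed
  qed
  then obtain r where r: "r > 0"
    and near: "\<And>w. dist w z < r \<Longrightarrow> w \<in> gph F \<Longrightarrow> norm (fst w - fst z) \<le> \<kappa>' * norm (snd w - snd z)"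
    by (auto simp: eventually_nhds_metric)
  \<comment> \<open>Calmness puts no restriction on \<open>y'\<close>. If \<open>y'\<close> is
    within \<open>r / 2\<close> of \<open>snd z\<close>, the pair is close to \<open>z\<close>;
    otherwise \<open>\<kappa>' * (r / 2)\<close> already dominates
    \<open>norm (x' - fst z)\<close>.\<close>
  define s where "s = min (r / 2) (\<kappa>' * (r / 2))"
  have "s > 0"
    using r assms by (simp add: s_def)
  then have "\<forall>\<^sub>F x' in nhds (fst z). x' \<in> ball (fst z) s"
    by (intro eventually_nhds_in_open) auto
  then show ?thesis
    unfolding isolated_calm_constant_def
  proof eventually_elim
    case (elim x')
    then have x': "norm (x' - fst z) < s"
      by (simp add: dist_norm norm_minus_commute)
    show ?case
    proof
      fix y' assume y': "y' \<in> F x'"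
      show "norm (x' - fst z) \<le> \<kappa>' * norm (y' - snd z)"
      proof (cases "norm (y' - snd z) < r / 2")
        case True
        have "dist (x', y') z < r"
          using norm_Pair_le[of "x' - fst z" "y' - snd z"] True x'
          by (simp add: dist_norm minus_prod_def s_def)
        then show ?thesis
          using near[of "(x', y')"] y' by (simp add: gph_def)
      next
        case False
        then have "\<kappa>' * (r / 2) \<le> \<kappa>' * norm (y' - snd z)"
          using assms by (intro mult_left_mono) auto
        then show ?thesis
          using x' by (simp add: s_def)
      qed
    qed
  qed
qed

section \<open>Comparison of the two moduli\<close>

lemma calm_of_subreg_less:
  assumes "strongly_metrically_subregular_at F z" "subreg F z < ereal \<kappa>"
  shows "isolated_calm_constant F z \<kappa>"
proof -
  obtain \<kappa>0 where "subreg_constant F z \<kappa>0" "\<kappa>0 < \<kappa>"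
    using assms(2) by (auto simp: subreg_def Inf_less_iff)
  then have "isolated_calm_constant F z \<kappa>0" "\<kappa>0 \<le> \<kappa>"
    using strongly_subregular_imp_calm[OF assms(1)] by auto
  then show ?thesis
    unfolding isolated_calm_constant_def
    by (auto elim!: eventually_mono dest!: bspec intro: order_trans[OF _ mult_right_mono])
qed

text \<open>The trace filter retains \<open>z\<close>, so it is proper even if \<open>z\<close> is
  isolated in the graph, and its limsup inherits the sign of \<open>subreg\<close>.\<close>

lemma l_subreg_nonneg:
  assumes "z \<in> gph F"
  shows "0 \<le> l_subreg F z"
proof -
  have "inf (nhds z) (principal (gph F)) \<noteq> bot"
    using assms eventually_nhds_x_imp_x
    by (auto simp: trivial_limit_def eventually_inf_principal)
  moreover have "0 \<le> subreg F w" for w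
    by (auto simp: subreg_def subreg_constant_def intro!: Inf_greatest)
  ultimately show ?thesis
    unfolding l_subreg_def by (intro le_Limsup always_eventually) auto
qed

lemma strongly_subregular_around_imp_bound:
  fixes F :: "'a::euclidean_space \<Rightarrow> 'a set"
  assumes sub: "\<forall>\<^sub>F w in nhds z. w \<in> gph F \<longrightarrow> strongly_metrically_subregular_at F w"
    and \<kappa>: "l_subreg F z < ereal \<kappa>" and vu: "(v, u) \<in> \<Union>(scd_adjoint F z)"
  shows "norm v \<le> \<kappa> * norm u"
proof -
  have "\<forall>\<^sub>F w in nhds z. w \<in> gph F \<longrightarrow> subreg F w < ereal \<kappa>"
    using Limsup_lessD[OF \<kappa>[unfolded l_subreg_def]] by (simp add: eventually_inf_principal)
  with sub have "\<forall>\<^sub>F w in nhds z. w \<in> gph F \<longrightarrow> isolated_calm_constant F w \<kappa>"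
    by eventually_elim (auto intro: calm_of_subreg_less)
  then show ?thesis
    using vu by (rule scd_adjoint_bound_of_calm)
qed

lemma scd_reg_le_l_subreg:
  fixes F :: "'a::euclidean_space \<Rightarrow> 'a set"
  assumes z: "z \<in> gph F" and sub: "strongly_metrically_subregular_around F z"
  shows "scd_reg F z \<le> l_subreg F z"
proof (rule ereal_le_real)
  fix \<kappa> assume le: "l_subreg F z \<le> ereal \<kappa>"
  have 0: "\<kappa> \<ge> 0"
    using order_trans[OF l_subreg_nonneg[OF z] le] by simp
  \<comment> \<open>The slack provides the strict inequality from which a limsup yields an eventual
    bound.\<close>
  have "scd_reg F z \<le> ereal (\<kappa> + \<epsilon>)" if "\<epsilon> > 0" for \<epsilon>
  proof (rule scd_reg_le)
    have "l_subreg F z < ereal (\<kappa> + \<epsilon>)"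
      by (rule order.strict_trans1[OF le]) (use that in simp)
    then show "norm v \<le> (\<kappa> + \<epsilon>) * norm u" if "(v, u) \<in> \<Union>(scd_adjoint F z)" for v u
      using strongly_subregular_around_imp_bound[OF _ _ that] sub
      unfolding strongly_metrically_subregular_around_def by blast
  qed (use 0 that in simp)
  then show "scd_reg F z \<le> ereal \<kappa>"
    by (simp add: ereal_le_epsilon2)
qed

lemma strongly_subregular_around_imp_regular:
  fixes F :: "'a::euclidean_space \<Rightarrow> 'a set"
  assumes sub: "strongly_metrically_subregular_around F z"
  shows "scd_adjoint F z \<subseteq> regular_subspaces"
proof -
  obtain \<kappa> where \<kappa>: "l_subreg F z < ereal \<kappa>"
    using sub less_PInf_Ex_of_nat[of "l_subreg F z"]
    unfolding strongly_metrically_subregular_around_def by auto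
  show ?thesis
  proof
    fix L assume L: "L \<in> scd_adjoint F z"
    have "v = 0" if "(v, 0) \<in> L" for v
    proof -
      have "norm v \<le> \<kappa> * norm (0 :: 'a)"
        using L that sub unfolding strongly_metrically_subregular_around_def
        by (intro strongly_subregular_around_imp_bound[OF _ \<kappa>]) auto
      then show ?thesis by simp
    qed
    then show "L \<in> regular_subspaces"
      using L by (auto simp: regular_subspaces_def scd_adjoint_def)
  qed
qed

lemma scd_regular_imp_subregular:
  fixes F :: "'a::euclidean_space \<Rightarrow> 'a set"
  assumes ss: "scd_semismooth_around F z" and reg: "scd_adjoint F z \<subseteq> regular_subspaces"
    and \<kappa>: "0 \<le> \<kappa>" "scd_reg F z < ereal \<kappa>" "\<kappa> < \<kappa>'"
  shows "\<forall>\<^sub>F w in nhds z. w \<in> gph F \<longrightarrow>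
    strongly_metrically_subregular_at F w \<and> subreg_constant F w \<kappa>'"
proof -
  \<comment> \<open>The bound is needed on a neighbourhood of each nearby \<open>w\<close>, since
    semismoothness is applied with \<open>w\<close> as base point.\<close>
  have "\<forall>\<^sub>F w in nhds z. \<forall>\<^sub>F w in nhds w. \<forall>(v, u)\<in>\<Union>(scd_adjoint F w). norm v \<le> \<kappa> * norm u"
    using eventually_scd_adjoint_bound_scd_reg[OF reg \<kappa>(2,1)] by (simp add: eventually_eventually)
  moreover have "\<forall>\<^sub>F w in nhds z. w \<in> gph F \<longrightarrow> scd_semismooth_at F w"
    using ss by (simp add: scd_semismooth_around_def)
  ultimately show ?thesis
  proof eventually_elim
    case (elim w)
    then show ?case
      using semismooth_imp_calm[of F w \<kappa> \<kappa>'] calm_imp_strongly_subregular[of w F \<kappa>'] \<kappa> by auto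
  qed
qed

lemma l_subreg_le_scd_reg:
  fixes F :: "'a::euclidean_space \<Rightarrow> 'a set"
  assumes ss: "scd_semismooth_around F z" and reg: "scd_adjoint F z \<subseteq> regular_subspaces"
    and nonneg: "0 \<le> scd_reg F z"
  shows "l_subreg F z \<le> scd_reg F z"
proof (rule ereal_le_real)
  fix \<kappa> assume le: "scd_reg F z \<le> ereal \<kappa>"
  have 0: "\<kappa> \<ge> 0"
    using order_trans[OF nonneg le] by simp
  have "l_subreg F z \<le> ereal (\<kappa> + \<epsilon>)" if "\<epsilon> > 0" for \<epsilon>
  proof -
    \<comment> \<open>One half of the slack exceeds \<open>scd_reg\<close>, the other absorbs the
      semismoothness error.\<close>
    have "scd_reg F z < ereal (\<kappa> + \<epsilon> / 2)"
      by (rule order.strict_trans1[OF le]) (use that in simp)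
    then have "\<forall>\<^sub>F w in nhds z. w \<in> gph F \<longrightarrow> subreg_constant F w (\<kappa> + \<epsilon>)"
      using eventually_mono[OF scd_regular_imp_subregular[OF ss reg _ _, of "\<kappa> + \<epsilon> / 2" "\<kappa> + \<epsilon>"]] 0 that
      by simp
    then show ?thesis
      unfolding l_subreg_def
      by (intro Limsup_bounded)
        (auto simp: eventually_inf_principal subreg_def elim!: eventually_mono intro!: Inf_lower)
  qed
  then show "l_subreg F z \<le> ereal \<kappa>"
    by (simp add: ereal_le_epsilon2)
qed

lemma scd_reg_finite:
  fixes F :: "'a::euclidean_space \<Rightarrow> 'a set"
  assumes "scd_adjoint F z \<subseteq> regular_subspaces"
  shows "scd_reg F z < \<infinity>"
proof -
  obtain k :: nat where "\<forall>\<^sub>F w in nhds z. \<forall>(v, u)\<in>\<Union>(scd_adjoint F w). norm v \<le> real k * norm u"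
    using scd_regular_imp_bounded[OF assms] .
  then have "scd_reg F z \<le> ereal (real k)"
    by (intro scd_reg_le) (auto dest!: eventually_nhds_x_imp_x)
  then show ?thesis
    by (rule order.strict_trans1) simp
qed

section \<open>The equivalence and the equality of the moduli\<close>

theorem corollary6p4:
  fixes F :: "real ^ 'n \<Rightarrow> (real ^ 'n) set" and x y :: "real ^ 'n"
  assumes "(x, y) \<in> gph F"
    and "locally_closed_around (gph F) (x, y)"
    and "scd_semismooth_around F (x, y)"
  shows "(strongly_metrically_subregular_around F (x, y) \<longleftrightarrow> scd_regular_around F (x, y)) \<and>
         (scd_regular_around F (x, y) \<longrightarrow> l_subreg F (x, y) = scd_reg F (x, y))"
proof -
  let ?z = "(x, y)"
  \<comment> \<open>Semismoothness at the reference point already contains the SCD property around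
    it, so only the inclusion in \<open>regular_subspaces\<close> remains of SCD regularity.\<close>
  have "scd_semismooth_at F ?z"
    using assms(1,3) eventually_nhds_x_imp_x unfolding scd_semismooth_around_def by blast
  then have around: "scd_property_around F ?z"
    by (simp add: scd_semismooth_at_def)
  then have "scd_property_at F ?z"
    using assms(1) eventually_nhds_x_imp_x unfolding scd_property_around_def by blast
  then have nonneg: "0 \<le> scd_reg F ?z"
    by (rule scd_reg_nonneg)
  have sub: "strongly_metrically_subregular_around F ?z" and le: "l_subreg F ?z \<le> scd_reg F ?z"
    if "scd_regular_around F ?z"
  proof -
    have reg: "scd_adjoint F ?z \<subseteq> regular_subspaces"
      using that by (simp add: scd_regular_around_def)
    show le: "l_subreg F ?z \<le> scd_reg F ?z"
      by (rule l_subreg_le_scd_reg[OF assms(3) reg nonneg])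
    obtain k :: nat where k: "scd_reg F ?z < ereal (real k)"
      using scd_reg_finite[OF reg] less_PInf_Ex_of_nat[of "scd_reg F ?z"] by auto
    have "\<forall>\<^sub>F w in nhds ?z. w \<in> gph F \<longrightarrow>
        strongly_metrically_subregular_at F w \<and> subreg_constant F w (real k + 1)"
      by (rule scd_regular_imp_subregular[OF assms(3) reg _ k]) simp_all
    then have "\<forall>\<^sub>F w in nhds ?z. w \<in> gph F \<longrightarrow> strongly_metrically_subregular_at F w"
      by (rule eventually_mono) blast
    then show "strongly_metrically_subregular_around F ?z"
      using order.strict_trans1[OF le scd_reg_finite[OF reg]]
      unfolding strongly_metrically_subregular_around_def by blast
  qed
  moreover have "scd_regular_around F ?z" if "strongly_metrically_subregular_around F ?z"
    using around strongly_subregular_around_imp_regular[OF that] by (simp add: scd_regular_around_def)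
  moreover have "scd_reg F ?z \<le> l_subreg F ?z" if "strongly_metrically_subregular_around F ?z"
    using assms(1) that by (rule scd_reg_le_l_subreg)
  ultimately show ?thesis
    using antisym by blast
qed

end
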